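(* Let $Z_1,\dots,Z_n,Z_{n+1}=(X_{n+1},Y_{n+1})$ be an exchangeable sequence of random variables in $\mathbb{R}^{p+1}$ whose conformity scores are almost surely distinct, and let $Q^{\mathrm{crisp}}$ be the crisp modification of the (split conformal) randomized predictive distribution, as defined in the context. Then $$\sup_{u\in(0,1)}\left|\mathbb{P}\bigl(Q^{\mathrm{crisp}}(Z_1,\dots,Z_n,(X_{n+1},Y_{n+1}))\le u\bigr)-u\right|\le\frac{1}{n-m}+\frac{1}{n-m+1}.$$
   Context: Write $z_i=(x_i,y_i)\in\mathbb{R}^p\times\mathbb{R}$. The first $m<n$ observations form the training set and $z_{m+1},\dots,z_n$ the calibration set. A point predictor $\hat y(\cdot)$ is fitted (measurably) on $z_1,\dots,z_m$ only. With the standard conformity measure $y-\hat y(x)$, the conformity scores are $E_i=y_{m+i}-\hat y(x_{m+i})$, $i=1,\dots,n-m$, together with the test score $y_{n+1}-\hat y(x_{n+1})$; standing assumption: these are almost surely distinct. The conformal atoms are $C_i=\hat y(x_{n+1})+E_i$, sorted as $C_{(1)}\le\dots\le C_{(n-m)}$, with $C_{(0)}=-\infty$ and $C_{(n-m+1)}=+\infty$. The crisp modification is $$Q^{\mathrm{crisp}}(z_1,\dots,z_n,(x_{n+1},y))=\frac{i}{n-m}\quad\text{if }y\in[C_{(i)},C_{(i+1)}),\qquad i=0,1,\dots,n-m.$$ *)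

theory Defs
  imports "HOL-Probability.Probability" "HOL-Combinatorics.Permutations"
begin

text \<open>
  An observation is a pair \<open>(x, y)\<close> in \<open>(real^'p) \<times> real\<close>. A data sequence \<open>z\<close> is a function on
  \<open>nat\<close>, of which the entries \<open>z 1, \<dots>, z n\<close> are used: \<open>z 1, \<dots>, z m\<close> for training and
  \<open>z (m + 1), \<dots>, z n\<close> for calibration.
\<close>

definition exchangeable :: "'w measure \<Rightarrow> 'i set \<Rightarrow> 'b measure \<Rightarrow> ('i \<Rightarrow> 'w \<Rightarrow> 'b) \<Rightarrow> bool" where
  "exchangeable M I N Z \<longleftrightarrow>
     (\<forall>i\<in>I. Z i \<in> measurable M N) \<and>
     (\<forall>\<pi>. \<pi> permutes I \<longrightarrow>
        distr M (PiM I (\<lambda>_. N)) (\<lambda>w. \<lambda>i\<in>I. Z (\<pi> i) w) =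
        distr M (PiM I (\<lambda>_. N)) (\<lambda>w. \<lambda>i\<in>I. Z i w))"

text \<open>
  A predictor takes the training data and a new object. It is only ever applied to \<open>z\<close> restricted
  to \<open>{1..m}\<close>, so that it cannot depend on any other observation.
\<close>

type_synonym 'p predictor = "(nat \<Rightarrow> (real^'p) \<times> real) \<Rightarrow> real^'p \<Rightarrow> real"

definition measurable_predictor :: "nat \<Rightarrow> 'p::finite predictor \<Rightarrow> bool" where
  "measurable_predictor m yhat \<longleftrightarrow>
     (\<lambda>(t, x). yhat t x) \<in> borel_measurable (PiM {1..m} (\<lambda>_. borel) \<Otimes>\<^sub>M borel)"

definition fitted :: "'p predictor \<Rightarrow> nat \<Rightarrow> (nat \<Rightarrow> (real^'p) \<times> real) \<Rightarrow> real^'p \<Rightarrow> real" where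
  "fitted yhat m z x = yhat (restrict z {1..m}) x"

definition conformity_score ::
    "'p predictor \<Rightarrow> nat \<Rightarrow> (nat \<Rightarrow> (real^'p) \<times> real) \<Rightarrow> (real^'p) \<times> real \<Rightarrow> real" where
  "conformity_score yhat m z = (\<lambda>(x, y). y - fitted yhat m z x)"

definition conformal_atom ::
    "'p predictor \<Rightarrow> nat \<Rightarrow> (nat \<Rightarrow> (real^'p) \<times> real) \<Rightarrow> real^'p \<Rightarrow> nat \<Rightarrow> real" where
  "conformal_atom yhat m z x i = fitted yhat m z x + conformity_score yhat m z (z (m + i))"

definition sorted_atom ::
    "'p predictor \<Rightarrow> nat \<Rightarrow> nat \<Rightarrow> (nat \<Rightarrow> (real^'p) \<times> real) \<Rightarrow> real^'p \<Rightarrow> nat \<Rightarrow> ereal" where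
  "sorted_atom yhat m n z x i =
     (if i = 0 then -\<infinity>
      else if i \<le> n - m
        then ereal (sort (map (conformal_atom yhat m z x) [1..<n - m + 1]) ! (i - 1))
      else \<infinity>)"

text \<open>The index below exists uniquely, also in the presence of ties; see \<open>Q_crisp_eq\<close>.\<close>

definition Q_crisp ::
    "'p predictor \<Rightarrow> nat \<Rightarrow> nat \<Rightarrow> (nat \<Rightarrow> (real^'p) \<times> real) \<Rightarrow> (real^'p) \<times> real \<Rightarrow> real" where
  "Q_crisp yhat m n z = (\<lambda>(x, y).
     real (THE i. i \<le> n - m \<and>
       ereal y \<in> {sorted_atom yhat m n z x i ..< sorted_atom yhat m n z x (i + 1)}) / real (n - m))"

lemma sorted_atom_mono:
  assumes "i \<le> j"
  shows "sorted_atom yhat m n z x i \<le> sorted_atom yhat m n z x j"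
proof -
  have "sort (map (conformal_atom yhat m z x) [1..<n - m + 1]) ! (i - 1)
      \<le> sort (map (conformal_atom yhat m z x) [1..<n - m + 1]) ! (j - 1)"
    if "i \<noteq> 0" "j \<le> n - m"
    by (rule sorted_nth_mono) (use assms that in auto)
  then show ?thesis
    using assms by (auto simp: sorted_atom_def)
qed

lemma ex1_sorted_atom:
  "\<exists>!i. i \<le> n - m \<and>
     ereal y \<in> {sorted_atom yhat m n z x i ..< sorted_atom yhat m n z x (i + 1)}"
proof -
  let ?c = "sorted_atom yhat m n z x"
  let ?A = "{i. i \<le> n - m \<and> ?c i \<le> ereal y}"
  have fin: "finite ?A" by simp
  have "0 \<in> ?A" by (simp add: sorted_atom_def)
  then have k: "Max ?A \<in> ?A" using fin by (metis Max_in empty_iff)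
  have "ereal y < ?c (Max ?A + 1)"
  proof (rule ccontr)
    assume *: "\<not> ereal y < ?c (Max ?A + 1)"
    then have "Max ?A + 1 \<le> n - m"
      by (cases "Max ?A + 1 \<le> n - m") (simp_all add: sorted_atom_def)
    with * have "Max ?A + 1 \<in> ?A" by simp
    then show False using Max_ge[OF fin] by fastforce
  qed
  moreover have "\<not> i < j"
    if "ereal y < ?c (i + 1)" "?c j \<le> ereal y" for i j
    using that sorted_atom_mono[of "i + 1" j yhat m n z x] by auto
  ultimately show ?thesis
    using k by (intro ex1I[of _ "Max ?A"]) (auto, meson linorder_neqE_nat)
qed

lemma Q_crisp_eq:
  assumes "i \<le> n - m"
    and "ereal y \<in> {sorted_atom yhat m n z x i ..< sorted_atom yhat m n z x (i + 1)}"
  shows "Q_crisp yhat m n z (x, y) = real i / real (n - m)"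
  unfolding Q_crisp_def using the1_equality[OF ex1_sorted_atom] assms by force

end

theory Submission imports Defs begin

text \<open>
  Up to the factor \<open>1 / (n - m)\<close>, \<open>Q_crisp\<close> at the test point counts the calibration scores not
  exceeding the test score, so it is one less than the rank \<open>R\<close> of the test score among all
  \<open>n - m + 1\<close> scores. Swapping the test point with a calibration point leaves the fitted predictor
  unchanged, so by exchangeability all scores have equally distributed ranks; as exactly \<open>r\<close> of
  them have rank at most \<open>r\<close>, \<open>P(R \<le> r) = r / (n - m + 1)\<close>. For \<open>k = \<lfloor>u (n - m)\<rfloor>\<close> the probability
  in question is \<open>(k + 1) / (n - m + 1)\<close>, which is within \<open>1 / (n - m + 1)\<close> of \<open>u\<close>.
\<close>

text \<open>The entries at most \<open>y\<close> form a prefix of a sorted list, so the length of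
  that prefix decides every position. This locates the test label among the sorted atoms.\<close>

lemma sorted_nth_le_iff_less_length_filter:
  fixes xs :: "'a::linorder list"
  assumes "sorted xs" "j < length xs"
  shows "xs ! j \<le> y \<longleftrightarrow> j < length (filter (\<lambda>x. x \<le> y) xs)"
  using assms
proof (induction xs arbitrary: j)
  case (Cons a xs)
  show ?case
  proof (cases "a \<le> y")
    case True
    then show ?thesis using Cons by (cases j) auto
  next
    case False
    have *: "y < x" if "x \<in> set (a # xs)" for x
      using that False Cons.prems(1) by auto
    then have "filter (\<lambda>x. x \<le> y) (a # xs) = []"
      by (auto simp: filter_empty_conv not_le)
    moreover have "y < (a # xs) ! j"
      using * Cons.prems(2) nth_mem by blast
    ultimately show ?thesis by (auto simp: not_le)
  qed
qed simp

text \<open>Injectivity of \<open>s\<close> makes ranking a bijection from \<open>I\<close> onto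
  \<open>{1..card I}\<close>, so the elements counted correspond to the ranks in
  \<open>{1..r}\<close>.\<close>

lemma card_rank_le:
  fixes s :: "'i \<Rightarrow> 'a::linorder"
  assumes fin: "finite I" and inj: "inj_on s I" and r: "r \<le> card I"
  shows "card {k \<in> I. card {i \<in> I. s i \<le> s k} \<le> r} = r"
proof -
  define R where "R k = card {i \<in> I. s i \<le> s k}" for k
  \<comment> \<open>The inclusion of the two counted sets is strict because \<open>l\<close> itself
    lies only in the larger one.\<close>
  have less: "R k < R l" if "k \<in> I" "l \<in> I" "s k < s l" for k l
    unfolding R_def using that fin
    by (intro psubset_card_mono) (auto simp: psubset_eq, force)
  have injR: "inj_on R I"
  proof (rule inj_onI)
    fix k l assume "k \<in> I" "l \<in> I" "R k = R l"
    then show "k = l"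
      using less[of k l] less[of l k] inj by (metis inj_onD less_irrefl linorder_neqE)
  qed
  have "R ` I \<subseteq> {1..card I}"
    using fin by (auto simp: R_def Suc_le_eq card_gt_0_iff intro: card_mono)
  then have img: "R ` I = {1..card I}"
    using card_image[OF injR] by (intro card_subset_eq) auto
  have "R ` {k \<in> I. R k \<le> r} = {x \<in> R ` I. x \<le> r}" by auto
  also have "\<dots> = {1..r}" using img r by auto
  finally have "card (R ` {k \<in> I. R k \<le> r}) = r" by simp
  then show ?thesis
    using card_image[OF inj_on_subset[OF injR, of "{k \<in> I. R k \<le> r}"]] by (simp add: R_def)
qed

text \<open>Turns the equality of laws into an equality of event probabilities, the form in which
  exchangeability is applied to rank events.\<close>

lemma exchangeable_measure_permute:
  assumes "exchangeable M I N Z" "\<pi> permutes I" "B \<in> sets (PiM I (\<lambda>_. N))"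
  shows "measure M {w \<in> space M. (\<lambda>i\<in>I. Z (\<pi> i) w) \<in> B}
       = measure M {w \<in> space M. (\<lambda>i\<in>I. Z i w) \<in> B}"
proof -
  have Z: "Z i \<in> measurable M N" if "i \<in> I" for i
    using assms(1) that by (auto simp: exchangeable_def)
  have meas: "(\<lambda>w. \<lambda>i\<in>I. Z (\<tau> i) w) \<in> measurable M (PiM I (\<lambda>_. N))"
    if "\<tau> permutes I" for \<tau>
    using that by (intro measurable_restrict Z) (simp add: permutes_in_image)
  have "measure (distr M (PiM I (\<lambda>_. N)) (\<lambda>w. \<lambda>i\<in>I. Z (\<tau> i) w)) B
      = measure M {w \<in> space M. (\<lambda>i\<in>I. Z (\<tau> i) w) \<in> B}" if "\<tau> permutes I" for \<tau>
    using measure_distr[OF meas[OF that] assms(3)]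
    by (simp add: vimage_def Int_def conj_commute)
  from this[OF assms(2)] this[OF permutes_id] show ?thesis
    using assms(1,2) by (simp add: exchangeable_def)
qed

text \<open>Adding the prediction at the test object turns calibration scores into atoms and the
  test score into the test label, so comparing atoms with the label is comparing scores. The
  intervals are closed on the left, so a tied score is counted.\<close>

lemma Q_crisp_eq_card:
  assumes "m < n"
  shows "Q_crisp yhat m n z (z (n + 1)) =
    real (card {i \<in> {m + 1..n}. conformity_score yhat m z (z i)
                               \<le> conformity_score yhat m z (z (n + 1))}) / real (n - m)"
proof -
  obtain x y where xy: "z (Suc n) = (x, y)" by (cases "z (Suc n)")
  define a where "a = conformal_atom yhat m z x"
  define xs where "xs = sort (map a [1..<n - m + 1])"
  define k where "k = length (filter (\<lambda>t. t \<le> y) xs)"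
  have len: "length xs = n - m" using assms by (simp add: xs_def Suc_diff_Suc)
  have nth: "xs ! j \<le> y \<longleftrightarrow> j < k" if "j < n - m" for j
    unfolding k_def using that len
    by (intro sorted_nth_le_iff_less_length_filter) (auto simp: xs_def)
  have k_le: "k \<le> n - m"
    unfolding k_def using len by (metis length_filter_le)
  have atom: "sorted_atom yhat m n z x i =
      (if i = 0 then -\<infinity> else if i \<le> n - m then ereal (xs ! (i - 1)) else \<infinity>)" for i
    by (simp add: sorted_atom_def xs_def a_def)
  have "ereal y \<in> {sorted_atom yhat m n z x k ..< sorted_atom yhat m n z x (k + 1)}"
    \<comment> \<open>\<open>sorted_atom\<close> counts from 1 and \<open>!\<close> from 0, so the
      ends are \<open>xs ! (k - 1)\<close> and \<open>xs ! k\<close>, except that the lower end is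
      infinite for \<open>k = 0\<close> and the upper one for \<open>k = n - m\<close>.\<close>
    using k_le nth[of "k - 1"] nth[of k] by (cases "k < n - m") (auto simp: atom not_le)
  then have Q: "Q_crisp yhat m n z (x, y) = real k / real (n - m)"
    by (rule Q_crisp_eq[OF k_le])
  \<comment> \<open>Sorting preserves the multiset of atoms, hence the count.\<close>
  have "k = length (filter (\<lambda>t. t \<le> y) (map a [1..<n - m + 1]))"
    by (simp only: k_def xs_def mset_filter mset_sort flip: size_mset)
  also have "\<dots> = length (filter (\<lambda>i. a i \<le> y) [1..<n - m + 1])"
    by (simp add: filter_map comp_def del: upt_Suc)
  also have "\<dots> = card {i \<in> {1..n - m}. a i \<le> y}"
    by (subst distinct_length_filter) (auto intro!: arg_cong[where f = card])
  also have "\<dots> = card ((\<lambda>i. m + i) ` {i \<in> {1..n - m}. a i \<le> y})"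
    by (simp add: card_image)
  also have "(\<lambda>i. m + i) ` {i \<in> {1..n - m}. a i \<le> y} =
      {i \<in> {m + 1..n}. conformity_score yhat m z (z i) \<le> conformity_score yhat m z (z (n + 1))}"
    (is "?L = ?R")
  proof (intro equalityI subsetI)
    fix i assume "i \<in> ?L"
    then show "i \<in> ?R"
      by (auto simp: a_def conformal_atom_def xy conformity_score_def
          split: prod.splits)
  next
    fix i assume i: "i \<in> ?R"
    then have "i - m \<in> {i \<in> {1..n - m}. a i \<le> y}" "i = m + (i - m)"
      by (auto simp: a_def conformal_atom_def xy conformity_score_def split: prod.splits)
    then show "i \<in> ?L" by blast
  qed
  finally show ?thesis using Q xy by simp
qed

lemma measurable_conformity_score:
  fixes yhat :: "'p::finite predictor"
  assumes yhat: "measurable_predictor m yhat" and "{1..m} \<subseteq> J" "i \<in> J"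
  shows "(\<lambda>z. conformity_score yhat m z (z i)) \<in> borel_measurable (PiM J (\<lambda>_. borel))"
proof -
  \<comment> \<open>\<open>borel_prod\<close> identifies the Borel sets of pairs with the product
    sigma-algebra, so both projections are measurable.\<close>
  have z: "(\<lambda>z. z i) \<in> measurable (PiM J (\<lambda>_. borel)) (borel \<Otimes>\<^sub>M borel :: ((real^'p) \<times> real) measure)"
    unfolding borel_prod using assms(3) by (rule measurable_component_singleton)
  have "(\<lambda>z. (restrict z {1..m}, fst (z i)))
      \<in> measurable (PiM J (\<lambda>_. borel :: ((real^'p) \<times> real) measure)) (PiM {1..m} (\<lambda>_. borel) \<Otimes>\<^sub>M (borel :: (real^'p) measure))"
    using measurable_compose[OF z measurable_fst] assms(2) by (intro measurable_Pair measurable_restrict_subset)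
  then have "(\<lambda>z. yhat (restrict z {1..m}) (fst (z i))) \<in> borel_measurable (PiM J (\<lambda>_. borel))"
    using measurable_compose yhat[unfolded measurable_predictor_def] by fastforce
  then show ?thesis
    using measurable_compose[OF z measurable_snd]
    by (simp add: conformity_score_def fitted_def case_prod_beta)
qed

lemma prob_rank_le:
  fixes Z :: "nat \<Rightarrow> 'w \<Rightarrow> (real^'p::finite) \<times> real"
    and yhat :: "'p predictor"
    and m n :: nat
  defines "s \<equiv> \<lambda>z i. conformity_score yhat m z (z i)"
  assumes "prob_space M"
    and "m < n"
    and yhat: "measurable_predictor m yhat"
    and exch: "exchangeable M {1..n + 1} borel Z"
    and distinct: "AE w in M. inj_on (s (\<lambda>j. Z j w)) {m + 1..n + 1}"
    and r: "r \<le> n - m + 1"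
  shows "measure M {w \<in> space M. card {i \<in> {m + 1..n + 1}.
           s (\<lambda>j. Z j w) i \<le> s (\<lambda>j. Z j w) (n + 1)} \<le> r} = real r / real (n - m + 1)"
proof -
  interpret prob_space M by fact
  define J where "J = {1..n + 1}"
  define I where "I = {m + 1..n + 1}"
  define P where "P = PiM J (\<lambda>_. borel :: ((real^'p) \<times> real) measure)"
  \<comment> \<open>The rank takes a data sequence, not a sample point, so that rank events become
    preimages of sets in \<open>P\<close>.\<close>
  define R where "R z k = card {i \<in> I. s z i \<le> s z k}" for z k
  define A where "A k = {w \<in> space M. R (\<lambda>j. Z j w) k \<le> r}" for k
  have sub: "I \<subseteq> J" "{1..m} \<subseteq> J" using \<open>m < n\<close> by (auto simp: I_def J_def)
  have finI: "finite I" and cardI: "card I = n - m + 1" and nI: "n + 1 \<in> I"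
    using \<open>m < n\<close> by (auto simp: I_def)
  have s_meas: "(\<lambda>z. s z i) \<in> borel_measurable P" if "i \<in> I" for i
    unfolding s_def P_def using that sub
    by (intro measurable_conformity_score[OF yhat]) auto
  have B: "{z \<in> space P. R z k \<le> r} \<in> sets P" if "k \<in> I" for k
  proof -
    \<comment> \<open>As a finite sum of indicators, the cardinality inherits measurability from the
      score comparisons.\<close>
    have "R z k = (\<Sum>i\<in>I. if s z i \<le> s z k then 1 else 0)" for z
      unfolding R_def using finI by (simp add: sum.If_cases Int_def)
    moreover have "(\<lambda>z. \<Sum>i\<in>I. if s z i \<le> s z k then 1 else (0::nat)) \<in> measurable P (count_space UNIV)"
      using s_meas that
      by (intro measurable_sum_nat measurable_If borel_measurable_le) auto
    ultimately have "(\<lambda>z. R z k) \<in> measurable P (count_space UNIV)" by simp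
    then show ?thesis by measurable
  qed
  have Z: "(\<lambda>w. \<lambda>i\<in>J. Z i w) \<in> measurable M P"
    unfolding P_def using exch by (intro measurable_restrict) (auto simp: exchangeable_def J_def)
  \<comment> \<open>The laws in \<open>exchangeable\<close> live on sequences restricted to
    \<open>J\<close>; scores with index in \<open>I\<close> read no entry outside
    \<open>J\<close>.\<close>
  have s_restrict: "s (restrict z J) i = s z i" if "i \<in> I" for z i
    using that sub by (auto simp: s_def conformity_score_def fitted_def Int_absorb1 Int_absorb2)
  have R_restrict: "R (restrict z J) k = R z k" if "k \<in> I" for z k
    unfolding R_def using that s_restrict by (metis (no_types, lifting))
  have A_eq: "A k = {w \<in> space M. (\<lambda>i\<in>J. Z i w) \<in> {z \<in> space P. R z k \<le> r}}" if "k \<in> I" for k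
    using measurable_space[OF Z] R_restrict[OF that] by (auto simp: A_def)
  have A_sets: "A k \<in> events" if "k \<in> I" for k
    unfolding A_eq[OF that] using measurable_sets[OF Z B[OF that]]
    by (simp add: vimage_def Int_def conj_commute)
  have A_prob: "prob (A k) = prob (A (n + 1))" if k: "k \<in> I" for k
  proof -
    \<comment> \<open>Both indices exceed \<open>m\<close>, so \<pi> fixes the training data and
      with them the fitted predictor.\<close>
    define \<pi> where "\<pi> = Transposition.transpose k (n + 1)"
    have perm: "\<pi> permutes I" "\<pi> permutes J"
      using k nI sub unfolding \<pi>_def by (auto intro!: permutes_swap_id)
    have \<pi>_last: "\<pi> (Suc n) = k" by (simp add: \<pi>_def)
    have fix_train: "\<pi> i = i" if "i \<in> {1..m}" for i
      using perm(1) that by (auto simp: permutes_def I_def)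
    have s_perm: "s (z \<circ> \<pi>) i = s z (\<pi> i)" for z i
    proof -
      have "restrict (z \<circ> \<pi>) {1..m} = restrict z {1..m}"
        using fix_train by (auto simp: restrict_def)
      then show ?thesis by (simp add: s_def conformity_score_def fitted_def)
    qed
    have R_perm: "R (z \<circ> \<pi>) (n + 1) = R z k" for z
    proof -
      have "\<pi> ` {i \<in> I. s z (\<pi> i) \<le> s z k} = {i \<in> \<pi> ` I. s z i \<le> s z k}" by auto
      then have "R z k = card (\<pi> ` {i \<in> I. s z (\<pi> i) \<le> s z k})"
        by (simp add: R_def permutes_image[OF perm(1)])
      also have "\<dots> = card {i \<in> I. s z (\<pi> i) \<le> s z k}"
        using permutes_inj[OF perm(1)] by (intro card_image) (auto intro: inj_on_subset)
      finally show ?thesis by (simp add: R_def s_perm \<pi>_last)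
    qed
    have "A k = {w \<in> space M. (\<lambda>i\<in>J. Z (\<pi> i) w) \<in> {z \<in> space P. R z (n + 1) \<le> r}}"
    proof -
      have "(\<lambda>i\<in>J. Z (\<pi> i) w) \<in> space P" for w
        by (simp add: P_def space_PiM)
      moreover have "R (\<lambda>i\<in>J. Z (\<pi> i) w) (n + 1) = R (\<lambda>j. Z j w) k" for w
        using R_restrict[OF nI, of "(\<lambda>j. Z j w) \<circ> \<pi>"] R_perm[of "\<lambda>j. Z j w"] by (simp add: comp_def)
      ultimately show ?thesis by (simp add: A_def)
    qed
    then show ?thesis
      using exchangeable_measure_permute[OF exch[folded J_def] perm(2) B[OF nI, unfolded P_def],
          folded P_def]
      by (simp only: A_eq[OF nI])
  qed
  \<comment> \<open>Double counting: where the scores are distinct, exactly \<open>r\<close> of the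
    events \<open>A k\<close> occur. Taking expectations gives the sum of their equal
    probabilities.\<close>
  have "AE w in M. (\<Sum>k\<in>I. indicat_real (A k) w) = real r"
    using distinct AE_space
  proof eventually_elim
    case (elim w)
    have "(\<Sum>k\<in>I. indicat_real (A k) w) = real (card {k \<in> I. R (\<lambda>j. Z j w) k \<le> r})"
      using elim(2) finI by (simp add: A_def indicator_def sum.If_cases Int_def)
    also have "\<dots> = real r"
      unfolding R_def using card_rank_le[OF finI, of "s (\<lambda>j. Z j w)" r] elim(1) r cardI
      by (simp add: I_def)
    finally show ?case .
  qed
  then have "expectation (\<lambda>w. \<Sum>k\<in>I. indicat_real (A k) w) = expectation (\<lambda>_. real r)"
    using A_sets by (intro integral_cong_AE) auto
  also have "expectation (\<lambda>w. \<Sum>k\<in>I. indicat_real (A k) w) = (\<Sum>k\<in>I. prob (A k))"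
    using A_sets by (subst Bochner_Integration.integral_sum) (auto simp: emeasure_eq_measure)
  also have "\<dots> = real (n - m + 1) * prob (A (n + 1))"
    using A_prob cardI by simp
  finally have "prob (A (n + 1)) = real r / real (n - m + 1)"
    by (simp add: prob_space field_simps)
  then show ?thesis by (simp add: A_def R_def I_def)
qed

theorem corollary2:
  fixes M :: "'w measure"
    and Z :: "nat \<Rightarrow> 'w \<Rightarrow> (real^'p::finite) \<times> real"
    and yhat :: "'p predictor"
    and m n :: nat
  assumes "prob_space M"
    and "m < n"
    and "measurable_predictor m yhat"
    and "exchangeable M {1..n + 1} borel Z"
    and "AE w in M. inj_on (\<lambda>i. conformity_score yhat m (\<lambda>j. Z j w) (Z i w)) {m + 1..n + 1}"
  shows "(SUP u\<in>{0<..<1::real}.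
            \<bar>measure M {w \<in> space M. Q_crisp yhat m n (\<lambda>j. Z j w) (Z (n + 1) w) \<le> u} - u\<bar>)
         \<le> 1 / real (n - m) + 1 / real (n - m + 1)"
proof (rule cSUP_least)
  fix u :: real assume u: "u \<in> {0<..<1}"
  define N where "N = n - m"
  \<comment> \<open>The largest count \<open>c\<close> with \<open>c / N \<le> u\<close>. As
    \<open>u < 1\<close>, it is below \<open>N\<close>, so \<open>k + 1\<close> is an admissible
    rank bound in \<open>prob_rank_le\<close>.\<close>
  define k where "k = nat \<lfloor>u * real N\<rfloor>"
  have N: "0 < N" using assms(2) by (simp add: N_def)
  have k: "real k \<le> u * real N" "u * real N < real k + 1"
    using u by (simp_all add: k_def)
  moreover have "u * real N < real N" using u N by simp
  ultimately have kN: "k + 1 \<le> N + 1" by linarith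
  have "Q_crisp yhat m n z (z (n + 1)) \<le> u \<longleftrightarrow>
      card {i \<in> {m + 1..n + 1}. conformity_score yhat m z (z i)
                               \<le> conformity_score yhat m z (z (n + 1))} \<le> k + 1" for z
  proof -
    let ?P = "\<lambda>i. conformity_score yhat m z (z i) \<le> conformity_score yhat m z (z (n + 1))"
    let ?c = "card {i \<in> {m + 1..n}. ?P i}"
    \<comment> \<open>The test score is compared with itself too, so its rank exceeds the
      calibration count by one.\<close>
    have "{i \<in> {m + 1..n + 1}. ?P i} = insert (n + 1) {i \<in> {m + 1..n}. ?P i}"
      using assms(2) by (auto simp: le_Suc_eq)
    then have "card {i \<in> {m + 1..n + 1}. ?P i} = ?c + 1" by simp
    moreover have "Q_crisp yhat m n z (z (n + 1)) \<le> u \<longleftrightarrow> real ?c \<le> u * real N"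
      using Q_crisp_eq_card[OF assms(2), of yhat z] N by (simp add: N_def pos_divide_le_eq)
    moreover have "real ?c \<le> u * real N \<longleftrightarrow> ?c \<le> k"
      using k by linarith
    ultimately show ?thesis by simp
  qed
  from this[of "\<lambda>j. Z j w" for w]
  have "measure M {w \<in> space M. Q_crisp yhat m n (\<lambda>j. Z j w) (Z (n + 1) w) \<le> u}
      = real (k + 1) / real (N + 1)"
    using prob_rank_le[OF assms, of "k + 1"] kN by (simp add: N_def)
  moreover have "\<bar>real (k + 1) / real (N + 1) - u\<bar> \<le> 1 / real (N + 1)"
  proof -
    have "real (k + 1) / real (N + 1) - u = (real k + 1 - u * real N - u) / real (N + 1)"
      by (simp add: field_simps)
    \<comment> \<open>\<open>k + 1 - u * N\<close> lies in (0, 1] and \<open>u\<close> in (0, 1), so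
      their difference lies in (-1, 1).\<close>
    moreover have "\<bar>real k + 1 - u * real N - u\<bar> \<le> 1"
      using k u unfolding greaterThanLessThan_iff by linarith
    ultimately show ?thesis by (simp add: divide_right_mono)
  qed
  ultimately have "\<bar>measure M {w \<in> space M. Q_crisp yhat m n (\<lambda>j. Z j w) (Z (n + 1) w) \<le> u} - u\<bar>
      \<le> 1 / real (N + 1)"
    by simp
  also have "\<dots> \<le> 1 / real N + 1 / real (N + 1)" by simp
  finally show "\<bar>measure M {w \<in> space M. Q_crisp yhat m n (\<lambda>j. Z j w) (Z (n + 1) w) \<le> u} - u\<bar>
      \<le> 1 / real (n - m) + 1 / real (n - m + 1)"
    by (simp only: N_def)
\<comment> \<open>What remains is that the index set of the supremum is nonempty.\<close>
qed simp

end
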